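(* Let $X$ be a compact space and $\phi:X\to X$ a continuous selfmap. Then $H_{top}(\phi,\mathcal U)=\mathbf H_{\mathfrak{cov}}(\phi,\mathcal U)$ for every $\mathcal U\in\mathfrak{cov}(X)$, and so $h_{top}(\phi)=\mathbf h_{\mathfrak{cov}}(\phi)$.
   Context: $\mathfrak{cov}(X)$ is the family of all open covers of $X$ (the empty set may belong to a cover). For open covers, $\mathcal U_1\vee\dots\vee\mathcal U_m=\{\bigcap_{i=1}^mU_i:U_i\in\mathcal U_i\}$ and $\phi^{-n}(\mathcal U)=\{\phi^{-n}(U):U\in\mathcal U\}$; $N(\mathcal U)$ is the minimal cardinality of a finite subcover of $\mathcal U$. The topological entropy is defined by $H_{top}(\phi,\mathcal U)=\lim_{n\to\infty}\frac{\log N(\mathcal U\vee\phi^{-1}(\mathcal U)\vee\dots\vee\phi^{-n+1}(\mathcal U))}{n}$ and $h_{top}(\phi)=\sup\{H_{top}(\phi,\mathcal U):\mathcal U\in\mathfrak{cov}(X)\}$. A normed semigroup is a semigroup $(S,\cdot)$ with a function $v:S\to\mathbb R_{\ge0}$; for an endomorphism $\psi:S\to S$, $T_n(\psi,x)=x\cdot\psi(x)\cdots\psi^{n-1}(x)$, $h_{\mathfrak S}(\psi,x)=\limsup_{n\to\infty}\frac{v(T_n(\psi,x))}{n}$ and $h_{\mathfrak S}(\psi)=\sup_{x\in S}h_{\mathfrak S}(\psi,x)$. For compact $X$, $(\mathfrak{cov}(X),\vee)$ is a commutative normed monoid with norm $v(\mathcal U)=\log N(\mathcal U)$ and neutral element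 $\{X\}$; a continuous map $\phi:X\to Y$ induces $\mathfrak{cov}(\phi):\mathfrak{cov}(Y)\to\mathfrak{cov}(X)$, $\mathcal U\mapsto\phi^{-1}(\mathcal U)$. This is a contravariant functor, and the functorial entropy is $\mathbf H_{\mathfrak{cov}}(\phi,\mathcal U)=h_{\mathfrak S}(\mathfrak{cov}(\phi),\mathcal U)$, $\mathbf h_{\mathfrak{cov}}(\phi)=h_{\mathfrak S}(\mathfrak{cov}(\phi))$. *)

theory Defs
  imports "HOL-Analysis.Analysis"
begin

section \<open>Normed semigroups and their entropy\<close>

record 'a normed_semigroup =
  ns_carrier :: "'a set"
  ns_mult :: "'a \<Rightarrow> 'a \<Rightarrow> 'a"
  ns_norm :: "'a \<Rightarrow> real"

locale normed_semigroup =
  fixes S :: "'a normed_semigroup"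
  assumes mult_closed:
      "\<lbrakk>x \<in> ns_carrier S; y \<in> ns_carrier S\<rbrakk> \<Longrightarrow> ns_mult S x y \<in> ns_carrier S"
    and mult_assoc:
      "\<lbrakk>x \<in> ns_carrier S; y \<in> ns_carrier S; z \<in> ns_carrier S\<rbrakk>
        \<Longrightarrow> ns_mult S (ns_mult S x y) z = ns_mult S x (ns_mult S y z)"
    and norm_nonneg: "x \<in> ns_carrier S \<Longrightarrow> 0 \<le> ns_norm S x"

locale commutative_normed_monoid = normed_semigroup +
  fixes e :: 'a
  assumes neutral_closed: "e \<in> ns_carrier S"
    and neutral_left: "x \<in> ns_carrier S \<Longrightarrow> ns_mult S e x = x"
    and neutral_right: "x \<in> ns_carrier S \<Longrightarrow> ns_mult S x e = x"
    and mult_commute: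
      "\<lbrakk>x \<in> ns_carrier S; y \<in> ns_carrier S\<rbrakk> \<Longrightarrow> ns_mult S x y = ns_mult S y x"

definition ns_hom :: "'a normed_semigroup \<Rightarrow> 'b normed_semigroup \<Rightarrow> ('a \<Rightarrow> 'b) \<Rightarrow> bool" where
  "ns_hom S T \<psi> \<longleftrightarrow> \<psi> \<in> ns_carrier S \<rightarrow> ns_carrier T \<and>
     (\<forall>x\<in>ns_carrier S. \<forall>y\<in>ns_carrier S. \<psi> (ns_mult S x y) = ns_mult T (\<psi> x) (\<psi> y))"

text \<open>
  \<open>trajectory S \<psi> x n\<close> is \<open>x \<cdot> \<psi> x \<cdots> \<psi>\<^sup>n\<^sup>-\<^sup>1 x\<close>, defined for \<open>n \<ge> 1\<close>: a semigroup has no empty product,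
  so the value at \<open>n = 0\<close> is a dummy, which does not affect the limits below.
\<close>

fun trajectory :: "'a normed_semigroup \<Rightarrow> ('a \<Rightarrow> 'a) \<Rightarrow> 'a \<Rightarrow> nat \<Rightarrow> 'a" where
  "trajectory S \<psi> x 0 = x"
| "trajectory S \<psi> x (Suc 0) = x"
| "trajectory S \<psi> x (Suc (Suc n)) = ns_mult S (trajectory S \<psi> x (Suc n)) ((\<psi> ^^ Suc n) x)"

definition semigroup_entropy_at :: "'a normed_semigroup \<Rightarrow> ('a \<Rightarrow> 'a) \<Rightarrow> 'a \<Rightarrow> ereal" where
  "semigroup_entropy_at S \<psi> x =
     limsup (\<lambda>n. ereal (ns_norm S (trajectory S \<psi> x n) / real n))"

definition semigroup_entropy :: "'a normed_semigroup \<Rightarrow> ('a \<Rightarrow> 'a) \<Rightarrow> ereal" where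
  "semigroup_entropy S \<psi> = (SUP x\<in>ns_carrier S. semigroup_entropy_at S \<psi> x)"

section \<open>Open covers\<close>

definition open_covers :: "'a topology \<Rightarrow> 'a set set set" where
  "open_covers X = {\<U>. (\<forall>U\<in>\<U>. openin X U) \<and> \<Union>\<U> = topspace X}"

definition cover_join :: "'a set set \<Rightarrow> 'a set set \<Rightarrow> 'a set set" where
  "cover_join \<U> \<V> = {U \<inter> V | U V. U \<in> \<U> \<and> V \<in> \<V>}"

text \<open>The join of \<open>\<UU> 0, \<dots>, \<UU> (m - 1)\<close>; meaningful for \<open>m \<ge> 1\<close> only.\<close>

definition covers_join :: "nat \<Rightarrow> (nat \<Rightarrow> 'a set set) \<Rightarrow> 'a set set" where
  "covers_join m \<UU> = {(\<Inter>i\<in>{..<m}. U i) | U. \<forall>i<m. U i \<in> \<UU> i}"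

text \<open>For a map \<open>\<phi>\<close> from \<open>X\<close> to \<open>Y\<close> and a cover \<open>\<U>\<close> of \<open>Y\<close>, this is \<open>\<phi>\<^sup>-\<^sup>1(\<U>)\<close>.\<close>

definition cover_preimage :: "'a topology \<Rightarrow> ('a \<Rightarrow> 'b) \<Rightarrow> 'b set set \<Rightarrow> 'a set set" where
  "cover_preimage X \<phi> \<U> = (\<lambda>U. {x \<in> topspace X. \<phi> x \<in> U}) ` \<U>"

definition cover_number :: "'a topology \<Rightarrow> 'a set set \<Rightarrow> nat" where
  "cover_number X \<U> = (LEAST k. \<exists>\<V>\<subseteq>\<U>. finite \<V> \<and> \<Union>\<V> = topspace X \<and> card \<V> = k)"

text \<open>
  For the empty space the cover number is \<open>0\<close>; the convention \<open>ln 0 = 0\<close> then gives the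
  norm \<open>0\<close>.
\<close>

definition cov :: "'a topology \<Rightarrow> 'a set set normed_semigroup" where
  "cov X = \<lparr>ns_carrier = open_covers X, ns_mult = cover_join,
            ns_norm = (\<lambda>\<U>. ln (real (cover_number X \<U>)))\<rparr>"

section \<open>Topological entropy and functorial entropy\<close>

definition H_top :: "'a topology \<Rightarrow> ('a \<Rightarrow> 'a) \<Rightarrow> 'a set set \<Rightarrow> real" where
  "H_top X \<phi> \<U> =
     lim (\<lambda>n. ln (real (cover_number X (covers_join n (\<lambda>i. cover_preimage X (\<phi> ^^ i) \<U>)))) / real n)"

definition h_top :: "'a topology \<Rightarrow> ('a \<Rightarrow> 'a) \<Rightarrow> ereal" where
  "h_top X \<phi> = (SUP \<U>\<in>open_covers X. ereal (H_top X \<phi> \<U>))"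

definition H_cov :: "'a topology \<Rightarrow> ('a \<Rightarrow> 'a) \<Rightarrow> 'a set set \<Rightarrow> ereal" where
  "H_cov X \<phi> \<U> = semigroup_entropy_at (cov X) (cover_preimage X \<phi>) \<U>"

definition h_cov :: "'a topology \<Rightarrow> ('a \<Rightarrow> 'a) \<Rightarrow> ereal" where
  "h_cov X \<phi> = semigroup_entropy (cov X) (cover_preimage X \<phi>)"

section \<open>Well-definedness\<close>

lemma cover_join_in_open_covers:
  assumes "\<U> \<in> open_covers X" "\<V> \<in> open_covers X"
  shows "cover_join \<U> \<V> \<in> open_covers X"
proof -
  have "\<Union>(cover_join \<U> \<V>) = \<Union>\<U> \<inter> \<Union>\<V>"
    unfolding cover_join_def by blast
  then show ?thesis
    using assms by (auto simp: open_covers_def cover_join_def)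
qed

lemma cover_join_assoc: "cover_join (cover_join \<U> \<V>) \<W> = cover_join \<U> (cover_join \<V> \<W>)"
proof -
  have "cover_join (cover_join \<U> \<V>) \<W> = {U \<inter> V \<inter> W | U V W. U \<in> \<U> \<and> V \<in> \<V> \<and> W \<in> \<W>}"
    unfolding cover_join_def by blast
  also have "\<dots> = cover_join \<U> (cover_join \<V> \<W>)"
    unfolding cover_join_def Int_assoc by blast
  finally show ?thesis .
qed

lemma cover_join_commute: "cover_join \<U> \<V> = cover_join \<V> \<U>"
proof -
  have "cover_join \<U> \<V> \<subseteq> cover_join \<V> \<U>" for \<U> \<V> :: "'a set set"
  proof
    fix W assume "W \<in> cover_join \<U> \<V>"
    then obtain U V where "W = V \<inter> U" "U \<in> \<U>" "V \<in> \<V>"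
      unfolding cover_join_def using Int_commute by blast
    then show "W \<in> cover_join \<V> \<U>"
      unfolding cover_join_def by blast
  qed
  then show ?thesis by (intro equalityI)
qed

lemma cover_join_topspace:
  assumes "\<U> \<in> open_covers X"
  shows "cover_join {topspace X} \<U> = \<U>"
proof -
  have "topspace X \<inter> U = U" if "U \<in> \<U>" for U
    using assms that unfolding open_covers_def by blast
  then have "(\<lambda>U. topspace X \<inter> U) ` \<U> = \<U>"
    by simp
  moreover have "cover_join {topspace X} \<U> = (\<lambda>U. topspace X \<inter> U) ` \<U>"
    unfolding cover_join_def by blast
  ultimately show ?thesis by simp
qed

lemma commutative_normed_monoid_cov: "commutative_normed_monoid (cov X) {topspace X}"
proof
  fix \<U> assume \<U>: "\<U> \<in> ns_carrier (cov X)"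
  show "0 \<le> ns_norm (cov X) \<U>"
    by (cases "cover_number X \<U> = 0") (auto simp: cov_def)
  show "ns_mult (cov X) {topspace X} \<U> = \<U>"
    using \<U> by (simp add: cov_def cover_join_topspace)
  show "ns_mult (cov X) \<U> {topspace X} = \<U>"
    using \<U> by (simp add: cov_def cover_join_topspace cover_join_commute[of \<U>])
  show "ns_mult (cov X) \<U> \<V> = ns_mult (cov X) \<V> \<U>" for \<V>
    by (simp add: cov_def cover_join_commute[of \<U>])
next
  show "{topspace X} \<in> ns_carrier (cov X)"
    by (simp add: cov_def open_covers_def)
qed (simp_all add: cov_def cover_join_in_open_covers cover_join_assoc)

lemma Union_preimage:
  assumes "continuous_map X Y \<phi>" "\<Union>\<A> = topspace Y"
  shows "\<Union>((\<lambda>U. {x \<in> topspace X. \<phi> x \<in> U}) ` \<A>) = topspace X"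
proof -
  have "\<phi> x \<in> \<Union>\<A>" if "x \<in> topspace X" for x
    using funcset_mem[OF continuous_map_funspace[OF assms(1)] that] assms(2) by simp
  then show ?thesis by blast
qed

lemma ns_hom_cover_preimage:
  assumes "continuous_map X Y \<phi>"
  shows "ns_hom (cov Y) (cov X) (cover_preimage X \<phi>)"
proof -
  have "cover_preimage X \<phi> \<U> \<in> open_covers X" if "\<U> \<in> open_covers Y" for \<U>
  proof -
    have U: "openin Y U" if "U \<in> \<U>" for U
      using \<open>\<U> \<in> open_covers Y\<close> that by (simp add: open_covers_def)
    have "\<Union>(cover_preimage X \<phi> \<U>) = topspace X"
      using that unfolding cover_preimage_def open_covers_def
      by (intro Union_preimage[OF assms]) simp
    moreover have "openin X V" if V: "V \<in> cover_preimage X \<phi> \<U>" for V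
    proof -
      obtain U' where "U' \<in> \<U>" "V = {x \<in> topspace X. \<phi> x \<in> U'}"
        using V unfolding cover_preimage_def by (rule imageE)
      then show ?thesis
        using openin_continuous_map_preimage[OF assms U] by simp
    qed
    ultimately show ?thesis by (simp add: open_covers_def)
  qed
  moreover have "cover_preimage X \<phi> (cover_join \<U> \<V>)
      = cover_join (cover_preimage X \<phi> \<U>) (cover_preimage X \<phi> \<V>)" for \<U> \<V>
  proof -
    let ?p = "\<lambda>U. {x \<in> topspace X. \<phi> x \<in> U}"
    have Int: "?p (U \<inter> V) = ?p U \<inter> ?p V" for U V by blast
    show ?thesis
    proof (intro equalityI subsetI)
      fix W assume "W \<in> cover_preimage X \<phi> (cover_join \<U> \<V>)"
      then obtain U V where "U \<in> \<U>" "V \<in> \<V>" "W = ?p (U \<inter> V)"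
        unfolding cover_preimage_def cover_join_def by blast
      then show "W \<in> cover_join (cover_preimage X \<phi> \<U>) (cover_preimage X \<phi> \<V>)"
        unfolding Int cover_preimage_def cover_join_def by blast
    next
      fix W assume "W \<in> cover_join (cover_preimage X \<phi> \<U>) (cover_preimage X \<phi> \<V>)"
      then obtain U V where UV: "U \<in> \<U>" "V \<in> \<V>" "W = ?p U \<inter> ?p V"
        unfolding cover_preimage_def cover_join_def by blast
      have "U \<inter> V \<in> cover_join \<U> \<V>"
        unfolding cover_join_def using UV by blast
      then show "W \<in> cover_preimage X \<phi> (cover_join \<U> \<V>)"
        unfolding cover_preimage_def UV(3) Int[symmetric] by (rule imageI)
    qed
  qed
  ultimately show ?thesis
    by (simp add: ns_hom_def cov_def Pi_def)
qed

lemma cover_number_witness: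
  assumes "compact_space X" "\<U> \<in> open_covers X"
  obtains \<V> where "\<V> \<subseteq> \<U>" "finite \<V>" "\<Union>\<V> = topspace X" "card \<V> = cover_number X \<U>"
proof -
  have "\<exists>\<V>. finite \<V> \<and> \<V> \<subseteq> \<U> \<and> topspace X \<subseteq> \<Union>\<V>"
    using assms unfolding compact_space_alt open_covers_def by auto
  then obtain \<V> where "finite \<V>" "\<V> \<subseteq> \<U>" "topspace X \<subseteq> \<Union>\<V>" by auto
  moreover have "\<Union>\<V> = topspace X"
    using calculation assms(2) unfolding open_covers_def by blast
  ultimately have "\<exists>k. \<exists>\<V>\<subseteq>\<U>. finite \<V> \<and> \<Union>\<V> = topspace X \<and> card \<V> = k" by auto
  from LeastI_ex[OF this] show ?thesis
    using that unfolding cover_number_def by blast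
qed

lemma cover_number_le:
  assumes "\<V> \<subseteq> \<U>" "finite \<V>" "\<Union>\<V> = topspace X"
  shows "cover_number X \<U> \<le> card \<V>"
  unfolding cover_number_def using assms by (intro Least_le) auto

lemma cover_number_join_le:
  assumes "compact_space X" "\<U> \<in> open_covers X" "\<V> \<in> open_covers X"
  shows "cover_number X (cover_join \<U> \<V>) \<le> cover_number X \<U> * cover_number X \<V>"
proof -
  obtain A where A: "A \<subseteq> \<U>" "finite A" "\<Union>A = topspace X" "card A = cover_number X \<U>"
    using cover_number_witness[OF assms(1,2)] by blast
  obtain B where B: "B \<subseteq> \<V>" "finite B" "\<Union>B = topspace X" "card B = cover_number X \<V>"
    using cover_number_witness[OF assms(1,3)] by blast
  let ?C = "(\<lambda>(U, V). U \<inter> V) ` (A \<times> B)"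
  have "\<Union>?C = \<Union>A \<inter> \<Union>B" by auto
  moreover have "?C \<subseteq> cover_join \<U> \<V>"
    using A(1) B(1) by (auto simp: cover_join_def)
  ultimately have "cover_number X (cover_join \<U> \<V>) \<le> card ?C"
    using A B by (intro cover_number_le) auto
  also have "\<dots> \<le> card (A \<times> B)"
    using A B by (intro card_image_le) auto
  finally show ?thesis
    using A B by (simp add: card_cartesian_product)
qed

lemma cover_number_preimage_le:
  assumes "compact_space Y" "continuous_map X Y \<phi>" "\<U> \<in> open_covers Y"
  shows "cover_number X (cover_preimage X \<phi> \<U>) \<le> cover_number Y \<U>"
proof -
  obtain A where A: "A \<subseteq> \<U>" "finite A" "\<Union>A = topspace Y" "card A = cover_number Y \<U>"
    using cover_number_witness[OF assms(1,3)] by blast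
  let ?C = "(\<lambda>U. {x \<in> topspace X. \<phi> x \<in> U}) ` A"
  have "\<Union>?C = topspace X"
    by (rule Union_preimage[OF assms(2) A(3)])
  then have "cover_number X (cover_preimage X \<phi> \<U>) \<le> card ?C"
    using A by (intro cover_number_le) (auto simp: cover_preimage_def)
  also have "\<dots> \<le> card A"
    using A by (intro card_image_le) auto
  finally show ?thesis
    using A by simp
qed

lemma covers_joinI:
  assumes "\<And>i. i < m \<Longrightarrow> U i \<in> \<UU> i"
  shows "(\<Inter>i\<in>{..<m}. U i) \<in> covers_join m \<UU>"
  unfolding covers_join_def mem_Collect_eq by (intro exI[of _ U] conjI refl allI impI assms)

lemma covers_joinE:
  assumes "W \<in> covers_join m \<UU>"
  obtains U where "W = (\<Inter>i\<in>{..<m}. U i)" "\<And>i. i < m \<Longrightarrow> U i \<in> \<UU> i"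
  using assms unfolding covers_join_def by blast

lemma covers_join_add:
  assumes "m > 0" "n > 0"
  shows "covers_join (m + n) \<UU> = cover_join (covers_join m \<UU>) (covers_join n (\<lambda>i. \<UU> (m + i)))"
proof (intro equalityI subsetI)
  have split: "(\<Inter>i\<in>{..<m + n}. U i) = (\<Inter>i\<in>{..<m}. U i) \<inter> (\<Inter>i\<in>{..<n}. U (m + i))"
    for U :: "nat \<Rightarrow> 'a set"
  proof -
    have "{..<m + n} = {..<m} \<union> (\<lambda>i. m + i) ` {..<n}"
      by (simp add: lessThan_atLeast0 ivl_disj_un_two(3) add.commute[of m n])
    then show ?thesis by (simp add: INF_union image_image)
  qed
  {
    fix W assume "W \<in> covers_join (m + n) \<UU>"
    then obtain U where U: "W = (\<Inter>i\<in>{..<m + n}. U i)" "\<And>i. i < m + n \<Longrightarrow> U i \<in> \<UU> i"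
      by (rule covers_joinE) blast
    have "(\<Inter>i\<in>{..<m}. U i) \<in> covers_join m \<UU>"
      by (rule covers_joinI) (simp add: U(2))
    moreover have "(\<Inter>i\<in>{..<n}. U (m + i)) \<in> covers_join n (\<lambda>i. \<UU> (m + i))"
      by (rule covers_joinI) (simp add: U(2))
    ultimately show "W \<in> cover_join (covers_join m \<UU>) (covers_join n (\<lambda>i. \<UU> (m + i)))"
      unfolding cover_join_def U(1) split by blast
  }
  {
    fix W assume "W \<in> cover_join (covers_join m \<UU>) (covers_join n (\<lambda>i. \<UU> (m + i)))"
    then obtain A B where AB: "W = A \<inter> B" "A \<in> covers_join m \<UU>"
      "B \<in> covers_join n (\<lambda>i. \<UU> (m + i))"
      unfolding cover_join_def by blast
    obtain U where U: "A = (\<Inter>i\<in>{..<m}. U i)" "\<And>i. i < m \<Longrightarrow> U i \<in> \<UU> i"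
      using AB(2) by (rule covers_joinE) blast
    obtain V where V: "B = (\<Inter>i\<in>{..<n}. V i)" "\<And>i. i < n \<Longrightarrow> V i \<in> \<UU> (m + i)"
      using AB(3) by (rule covers_joinE) blast
    let ?U = "\<lambda>i. if i < m then U i else V (i - m)"
    have "W = (\<Inter>i\<in>{..<m + n}. ?U i)"
      unfolding split AB(1) U(1) V(1) by simp
    moreover have "?U i \<in> \<UU> i" if "i < m + n" for i
      using U(2)[of i] V(2)[of "i - m"] that by auto
    ultimately show "W \<in> covers_join (m + n) \<UU>"
      using covers_joinI[of "m + n" ?U \<UU>] by simp
  }
qed

lemma covers_join_1: "covers_join (Suc 0) \<UU> = \<UU> 0"
proof (intro equalityI subsetI)
  fix W assume "W \<in> covers_join (Suc 0) \<UU>"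
  then show "W \<in> \<UU> 0" by (rule covers_joinE) (simp add: lessThan_Suc)
next
  fix W assume "W \<in> \<UU> 0"
  then show "W \<in> covers_join (Suc 0) \<UU>"
    using covers_joinI[of "Suc 0" "\<lambda>_. W" \<UU>] by (simp add: lessThan_Suc)
qed

lemma covers_join_in_open_covers:
  assumes "n > 0" "\<And>i. i < n \<Longrightarrow> \<UU> i \<in> open_covers X"
  shows "covers_join n \<UU> \<in> open_covers X"
  using assms
proof (induction n)
  case (Suc n)
  show ?case
  proof (cases "n = 0")
    case False
    have "covers_join (Suc n) \<UU> = cover_join (covers_join n \<UU>) (\<UU> n)"
      using covers_join_add[of n 1 \<UU>] False by (simp add: covers_join_1)
    moreover have "covers_join n \<UU> \<in> open_covers X"
      using False by (intro Suc.IH Suc.prems) simp_all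
    ultimately show ?thesis
      using Suc.prems(2)[of n] cover_join_in_open_covers by simp
  qed (use Suc in \<open>simp add: covers_join_1\<close>)
qed simp

lemma cover_preimage_covers_join:
  assumes "n > 0"
  shows "cover_preimage X f (covers_join n \<UU>) = covers_join n (\<lambda>i. cover_preimage X f (\<UU> i))"
proof (intro equalityI subsetI)
  have eq: "{x \<in> topspace X. f x \<in> (\<Inter>i\<in>{..<n}. U i)}
    = (\<Inter>i\<in>{..<n}. {x \<in> topspace X. f x \<in> U i})" for U
    using assms by auto
  {
    fix W assume "W \<in> cover_preimage X f (covers_join n \<UU>)"
    then obtain A where A: "A \<in> covers_join n \<UU>" "W = {x \<in> topspace X. f x \<in> A}"
      unfolding cover_preimage_def by blast
    obtain U where U: "A = (\<Inter>i\<in>{..<n}. U i)" "\<And>i. i < n \<Longrightarrow> U i \<in> \<UU> i"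
      using A(1) by (rule covers_joinE) blast
    show "W \<in> covers_join n (\<lambda>i. cover_preimage X f (\<UU> i))"
      unfolding A(2) U(1) eq
      by (rule covers_joinI) (unfold cover_preimage_def, rule imageI, rule U(2))
  }
  {
    fix W assume "W \<in> covers_join n (\<lambda>i. cover_preimage X f (\<UU> i))"
    then obtain V where V: "W = (\<Inter>i\<in>{..<n}. V i)"
      "\<And>i. i < n \<Longrightarrow> V i \<in> cover_preimage X f (\<UU> i)"
      by (rule covers_joinE) blast
    have "\<exists>U. U \<in> \<UU> i \<and> V i = {x \<in> topspace X. f x \<in> U}" if "i < n" for i
      using V(2)[OF that] unfolding cover_preimage_def by blast
    then obtain U where U: "\<And>i. i < n \<Longrightarrow> U i \<in> \<UU> i"
      "\<And>i. i < n \<Longrightarrow> V i = {x \<in> topspace X. f x \<in> U i}"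
      by metis
    have "W = {x \<in> topspace X. f x \<in> (\<Inter>i\<in>{..<n}. U i)}"
      unfolding eq V(1) by (intro INF_cong refl U(2)) simp
    moreover have "(\<Inter>i\<in>{..<n}. U i) \<in> covers_join n \<UU>"
      by (rule covers_joinI) (rule U(1))
    ultimately show "W \<in> cover_preimage X f (covers_join n \<UU>)"
      unfolding cover_preimage_def by blast
  }
qed

lemma continuous_map_funpow:
  assumes "continuous_map X X f"
  shows "continuous_map X X (f ^^ n)"
proof (induction n)
  case (Suc n)
  show ?case
    unfolding funpow.simps by (rule continuous_map_compose[OF Suc.IH assms])
qed simp

lemma cover_preimage_funpow_add:
  assumes "continuous_map X X f"
  shows "cover_preimage X (f ^^ m) (cover_preimage X (f ^^ n) \<U>) = cover_preimage X (f ^^ (m + n)) \<U>"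
proof -
  have "{x \<in> topspace X. (f ^^ m) x \<in> {y \<in> topspace X. (f ^^ n) y \<in> U}}
      = {x \<in> topspace X. (f ^^ (m + n)) x \<in> U}" for U
    using funcset_mem[OF continuous_map_funspace[OF continuous_map_funpow[OF assms, of m]]]
    by (auto simp: add.commute[of m n] funpow_add)
  then show ?thesis
    unfolding cover_preimage_def image_image by (intro image_cong refl)
qed

text \<open>Fekete's lemma for nonnegative sequences.\<close>

lemma convergent_subadditive:
  fixes a :: "nat \<Rightarrow> real"
  assumes nonneg: "\<And>n. 0 \<le> a n"
    and sub: "\<And>m n. \<lbrakk>m > 0; n > 0\<rbrakk> \<Longrightarrow> a (m + n) \<le> a m + a n"
  shows "convergent (\<lambda>n. a n / real n)"
proof -
  define L where "L = (INF n\<in>{0<..}. a n / real n)"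
  have bdd: "bdd_below ((\<lambda>n. a n / real n) ` {0<..})"
    using nonneg by (intro bdd_belowI[of _ 0]) auto
  have lower: "L \<le> a n / real n" if "n > 0" for n
    unfolding L_def by (rule cINF_lower[OF bdd]) (use that in auto)
  have mult: "a (q * k + r) \<le> real q * a k + a r" if "k > 0" "r > 0" for q k r
  proof (induction q)
    case (Suc q)
    have "a (Suc q * k + r) = a (k + (q * k + r))" by (simp add: algebra_simps)
    also have "\<dots> \<le> a k + a (q * k + r)" using that by (intro sub) auto
    finally show ?case using Suc by (simp add: algebra_simps)
  qed simp
  have "(\<lambda>n. a n / real n) \<longlonglongrightarrow> L"
  proof (rule LIMSEQ_I)
    fix e :: real assume "e > 0"
    have "\<exists>k\<in>{0<..}. a k / real k < L + e / 2"
      using \<open>e > 0\<close> bdd unfolding L_def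
      by (subst cINF_less_iff[symmetric]) auto
    then obtain k where k: "k > 0" "a k / real k < L + e / 2" by auto
    define M where "M = (\<Sum>r\<in>{1..k}. a r)"
    obtain N where N: "N > 0" "M / real N < e / 2"
    proof -
      obtain N where "real N > 2 * M / e" using reals_Archimedean2 by blast
      then have "2 * M / e < real (Suc N)" by simp
      then have "M / real (Suc N) < e / 2"
        using \<open>e > 0\<close> by (simp add: field_simps)
      then show ?thesis using that[of "Suc N"] by simp
    qed
    have M0: "M \<ge> 0" unfolding M_def using nonneg by (intro sum_nonneg) auto
    have "norm (a n / real n - L) < e" if "n \<ge> N" for n
    proof -
      have n: "n > 0" using that N by simp
      define q where "q = (n - 1) div k"
      define r where "r = (n - 1) mod k + 1"
      have nq: "n = q * k + r"
        unfolding q_def r_def using n by (metis Suc_eq_plus1 Suc_pred' add_Suc_right div_mult_mod_eq)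
      have r: "r \<in> {1..k}" unfolding r_def using k(1) by (auto simp: Suc_le_eq)
      have "a r \<le> M" unfolding M_def
        using r nonneg by (intro member_le_sum) auto
      then have "a n \<le> real q * a k + M"
        using mult[of k r q] k(1) r nq by auto
      also have "real q * a k = real (q * k) * (a k / real k)"
        using k(1) by simp
      also have "\<dots> \<le> real n * (a k / real k)"
        using nq nonneg by (intro mult_right_mono) auto
      finally have "a n \<le> real n * (a k / real k) + M" by simp
      then have "a n / real n \<le> (real n * (a k / real k) + M) / real n"
        by (intro divide_right_mono) auto
      also have "\<dots> = a k / real k + M / real n"
        using n by (simp add: add_divide_distrib)
      also have "M / real n \<le> M / real N"
        using M0 N(1) that by (intro divide_left_mono) auto
      finally have "a n / real n < L + e" using k(2) N(2) by linarith
      then show ?thesis using lower[OF n] by simp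
    qed
    then show "\<exists>N. \<forall>n\<ge>N. norm (a n / real n - L) < e" by blast
  qed
  then show ?thesis by (auto simp: convergent_def)
qed

text \<open>The limit in the definition of \<^const>\<open>H_top\<close> exists.\<close>

theorem convergent_H_top:
  assumes X: "compact_space X" and \<phi>: "continuous_map X X \<phi>" and \<U>: "\<U> \<in> open_covers X"
  shows "convergent (\<lambda>n. ln (real (cover_number X
            (covers_join n (\<lambda>i. cover_preimage X (\<phi> ^^ i) \<U>)))) / real n)"
proof (rule convergent_subadditive)
  let ?J = "\<lambda>n. covers_join n (\<lambda>i. cover_preimage X (\<phi> ^^ i) \<U>)"
  show "0 \<le> ln (real (cover_number X (?J n)))" for n
    by (cases "cover_number X (?J n) = 0") auto
  fix m n :: nat assume mn: "m > 0" "n > 0"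
  have cov: "cover_preimage X (\<phi> ^^ i) \<V> \<in> open_covers X" if "\<V> \<in> open_covers X" for i \<V>
    using ns_hom_cover_preimage[OF continuous_map_funpow[OF \<phi>]] that
    by (auto simp: ns_hom_def cov_def)
  have J: "?J n \<in> open_covers X" if "n > 0" for n
    using that cov[OF \<U>] by (intro covers_join_in_open_covers)
  have "?J (m + n) = cover_join (?J m) (cover_preimage X (\<phi> ^^ m) (?J n))"
    using mn by (simp add: covers_join_add cover_preimage_covers_join cover_preimage_funpow_add[OF \<phi>])
  then have "cover_number X (?J (m + n))
      \<le> cover_number X (?J m) * cover_number X (cover_preimage X (\<phi> ^^ m) (?J n))"
    using cover_number_join_le[OF X J[OF mn(1)] cov[OF J[OF mn(2)]]] by simp
  also have "\<dots> \<le> cover_number X (?J m) * cover_number X (?J n)"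
    using cover_number_preimage_le[OF X continuous_map_funpow[OF \<phi>] J[OF mn(2)]] by simp
  finally have le: "cover_number X (?J (m + n)) \<le> cover_number X (?J m) * cover_number X (?J n)" .
  show "ln (real (cover_number X (?J (m + n))))
      \<le> ln (real (cover_number X (?J m))) + ln (real (cover_number X (?J n)))"
  proof (cases "cover_number X (?J (m + n)) = 0")
    case True
    have "0 \<le> ln (real k)" for k by (cases "k = 0") auto
    then show ?thesis using True by simp
  next
    case False
    then have pos: "cover_number X (?J m) > 0" "cover_number X (?J n) > 0"
      using le by (auto intro: Nat.gr0I)
    have "ln (real (cover_number X (?J (m + n))))
        \<le> ln (real (cover_number X (?J m) * cover_number X (?J n)))"
      using False le by (subst ln_le_cancel_iff) (use pos in \<open>auto simp del: of_nat_mult\<close>)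
    then show ?thesis using pos by (simp add: ln_mult)
  qed
qed

end

theory Submission
  imports Defs
begin

text \<open>Iterating the induced map on covers agrees with pulling back along iterates of
  \<open>\<phi>\<close>, so the semigroup trajectory of \<open>\<U>\<close> is the very join whose
  cover number defines \<open>H_top\<close> (\<open>trajectory_cov\<close>). Both entropies thus
  come from one sequence, once by \<open>lim\<close> and once by \<open>limsup\<close>; these agree
  because subadditivity makes the sequence converge (\<open>convergent_H_top\<close>). Suprema over
  all covers then agree too.\<close>

lemma funpow_cover_preimage:
  assumes "continuous_map X X \<phi>" and "\<U> \<in> open_covers X"
  shows "(cover_preimage X \<phi> ^^ n) \<U> = cover_preimage X (\<phi> ^^ n) \<U>"
proof (induction n)
  case 0
  have "{x \<in> topspace X. x \<in> U} = U" if "U \<in> \<U>" for U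
    using assms(2) that unfolding open_covers_def by blast
  then show ?case
    by (simp add: cover_preimage_def)
next
  case (Suc n)
  then show ?case
    using cover_preimage_funpow_add[OF assms(1), of 1 n \<U>] by (simp add: comp_def)
qed

text \<open>Each further trajectory factor is a one-cover block appended to the join. Indices start
  at \<open>Suc n\<close> because at 0 the two sides are \<open>\<U>\<close> and
  \<open>{UNIV}\<close>.\<close>

lemma trajectory_cov:
  assumes "continuous_map X X \<phi>" and "\<U> \<in> open_covers X"
  shows "trajectory (cov X) (cover_preimage X \<phi>) \<U> (Suc n)
    = covers_join (Suc n) (\<lambda>i. cover_preimage X (\<phi> ^^ i) \<U>)"
proof (induction n)
  case 0
  show ?case
    using funpow_cover_preimage[OF assms, of 0] by (simp add: covers_join_1)
next
  case (Suc n)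
  have "trajectory (cov X) (cover_preimage X \<phi>) \<U> (Suc (Suc n))
      = cover_join (covers_join (Suc n) (\<lambda>i. cover_preimage X (\<phi> ^^ i) \<U>))
          (cover_preimage X (\<phi> ^^ Suc n) \<U>)"
    by (simp only: trajectory.simps Suc.IH funpow_cover_preimage[OF assms])
      (simp add: cov_def)
  also have "\<dots> = covers_join (Suc (Suc n)) (\<lambda>i. cover_preimage X (\<phi> ^^ i) \<U>)"
    using covers_join_add[of "Suc n" 1 "\<lambda>i. cover_preimage X (\<phi> ^^ i) \<U>"]
    by (simp add: covers_join_1)
  finally show ?case .
qed

lemma H_top_eq_H_cov:
  assumes "compact_space X" and "continuous_map X X \<phi>" and "\<U> \<in> open_covers X"
  shows "ereal (H_top X \<phi> \<U>) = H_cov X \<phi> \<U>"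
proof -
  let ?a = "\<lambda>n. ln (real (cover_number X
    (covers_join n (\<lambda>i. cover_preimage X (\<phi> ^^ i) \<U>)))) / real n"
  \<comment> \<open>At \<open>n = 0\<close> both sides are divided by zero, hence equal to \<open>0\<close>.\<close>
  have "ns_norm (cov X) (trajectory (cov X) (cover_preimage X \<phi>) \<U> n) / real n = ?a n" for n
  proof (cases n)
    case (Suc k)
    show ?thesis
      unfolding Suc trajectory_cov[OF assms(2,3)] by (simp add: cov_def)
  qed simp
  then have "H_cov X \<phi> \<U> = limsup (\<lambda>n. ereal (?a n))"
    by (simp only: H_cov_def semigroup_entropy_at_def)
  \<comment> \<open>\<open>lim\<close> is only a description operator; proven convergence is what
    makes \<open>H_top\<close> an actual limit.\<close>
  moreover have "?a \<longlonglongrightarrow> H_top X \<phi> \<U>"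
    using convergent_H_top[OF assms] unfolding H_top_def convergent_LIMSEQ_iff .
  then have "limsup (\<lambda>n. ereal (?a n)) = ereal (H_top X \<phi> \<U>)"
    by (intro lim_imp_Limsup) simp_all
  ultimately show ?thesis by simp
qed

theorem theorem5p8:
  fixes X :: "'a topology" and \<phi> :: "'a \<Rightarrow> 'a"
  assumes "compact_space X" and "continuous_map X X \<phi>"
  shows "(\<forall>\<U>\<in>open_covers X. ereal (H_top X \<phi> \<U>) = H_cov X \<phi> \<U>) \<and> h_top X \<phi> = h_cov X \<phi>"
proof
  show eq: "\<forall>\<U>\<in>open_covers X. ereal (H_top X \<phi> \<U>) = H_cov X \<phi> \<U>"
    using H_top_eq_H_cov[OF assms] by blast
  \<comment> \<open>The carrier of \<open>cov X\<close> is \<open>open_covers X\<close>, so both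
    suprema have the same index set.\<close>
  have "h_cov X \<phi> = (SUP \<U>\<in>open_covers X. H_cov X \<phi> \<U>)"
    by (simp add: h_cov_def semigroup_entropy_def H_cov_def cov_def)
  then show "h_top X \<phi> = h_cov X \<phi>"
    unfolding h_top_def using eq by (simp cong: SUP_cong)
qed

end
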